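(* Let $n,m$ be positive integers with $n>m$. Any harmonic trinomial $f(\zeta)=a\zeta^n+b\overline{\zeta}^m+c$, $\zeta\in\mathbb{C}$, with $a,b,c$ non-zero complex numbers, has at most $n+2m$ roots in $\mathbb{C}$. Moreover, there exists a family $(g_r)_{r>0}$ of harmonic trinomials of this form (with exponents $n$ and $m$) such that each $g_r$ has exactly $n+2m$ roots in $\mathbb{C}$.
   Context: A harmonic trinomial with exponents $n>m$ is a function $\mathbb{C}\to\mathbb{C}$ of the form $\zeta\mapsto a\zeta^n+b\overline{\zeta}^m+c$ with $a,b,c\in\mathbb{C}\setminus\{0\}$. Roots are counted as distinct points of $\mathbb{C}$, without multiplicity. *)

theory Defs
  imports Complex_Main
begin

(* The constraint 0 < m < n on the exponents is not part of this definition;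
   it is to be assumed separately. *)
definition harmonic_trinomial :: "nat \<Rightarrow> nat \<Rightarrow> (complex \<Rightarrow> complex) \<Rightarrow> bool" where
  "harmonic_trinomial n m f \<longleftrightarrow>
     (\<exists>a b c. a \<noteq> 0 \<and> b \<noteq> 0 \<and> c \<noteq> 0 \<and> f = (\<lambda>\<zeta>. a * \<zeta> ^ n + b * cnj \<zeta> ^ m + c))"

definition roots :: "(complex \<Rightarrow> complex) \<Rightarrow> complex set" where
  "roots f = {\<zeta>. f \<zeta> = 0}"

end

theory Submission
  imports Defs
begin

text \<open>After division by \<open>c\<close> and the substitution \<open>w = z ^ gcd n m\<close> we may assume that the equation is
  \<open>a z\<^sup>n + b cnj z\<^sup>m = 1\<close> with \<open>n\<close>, \<open>m\<close> coprime. A root of modulus \<open>exp t\<close> closes a triangle with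
  sides \<open>1\<close>, \<open>U t = |a| exp (n t)\<close>, \<open>V t = |b| exp (m t)\<close>, whose shape depends only on \<open>t\<close>. Let
  \<open>\<phi>\<close> and \<open>\<psi>\<close> be the angles at the side \<open>1\<close>. Eliminating the argument of \<open>z\<close>, the roots correspond to the
  pairs of \<open>t\<close> and an orientation \<open>\<epsilon> = \<plusminus>1\<close> with \<open>cis (\<epsilon> D) = \<kappa>\<close>, where \<open>D = m \<phi> - n \<psi>\<close>
  and \<open>\<kappa>\<close> is a constant. Since \<open>D'\<close> has the sign of \<open>m V - n U\<close>, \<open>D\<close> increases from \<open>0\<close> to at most
  \<open>m \<pi>\<close> while \<open>n U \<le> m V\<close>, which gives at most \<open>m\<close> roots, and then decreases to
  \<open>- n \<pi>\<close>, which gives at most \<open>n + m\<close> more. Both bounds are attained if \<open>D\<close> reaches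
  \<open>m \<pi>\<close>, that is if \<open>V \<ge> U + 1\<close> somewhere, and \<open>\<kappa>\<close> is not real.\<close>

section \<open>Powers and arguments\<close>

text \<open>A Bezout relation \<open>p * n + q * m = 1\<close> suggests
  \<open>e = x powi p * w powi q\<close>; the hypothesis trades powers of \<open>x\<close> for
  powers of \<open>w\<close>. This later recovers the direction of a root from its
  \<open>n\<close>-th and \<open>m\<close>-th powers.\<close>

lemma ex_common_root:
  fixes x w :: "'a::field"
  assumes "coprime n m" "x \<noteq> 0" "w \<noteq> 0" "x ^ m = w ^ n"
  shows "\<exists>e. e ^ n = x \<and> e ^ m = w"
proof -
  obtain p q :: int where pq: "p * int n + q * int m = 1"
    using bezout_int[of "int n" "int m"] assms(1) by (auto simp: coprime_iff_gcd_eq_1)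
  have xw: "x powi (int m * k) = w powi (int n * k)" for k
    using assms(4) by (simp add: power_int_mult)
  define e where "e = x powi p * w powi q"
  have "e ^ n = x powi (int n * p) * w powi (int n * q)"
    unfolding e_def power_mult_distrib by (simp add: power_int_power' mult.commute)
  also have "\<dots> = x powi (int n * p + int m * q)"
    using assms(2) xw[of q] by (simp add: power_int_add)
  also have "int n * p + int m * q = 1" using pq by (simp add: mult.commute)
  finally have 1: "e ^ n = x" by simp
  have "e ^ m = x powi (int m * p) * w powi (int m * q)"
    unfolding e_def power_mult_distrib by (simp add: power_int_power' mult.commute)
  also have "\<dots> = w powi (int n * p + int m * q)"
    using assms(3) xw[of p] by (simp add: power_int_add)
  also have "int n * p + int m * q = 1" using pq by (simp add: mult.commute)
  finally have "e ^ m = w" by simp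
  with 1 show ?thesis by blast
qed

lemma coprime_powers_inj:
  fixes e e' :: "'a::field"
  assumes "coprime n m" "e \<noteq> 0" "e' \<noteq> 0" "e ^ n = e' ^ n" "e ^ m = e' ^ m"
  shows "e = e'"
proof -
  obtain p q :: int where pq: "p * int n + q * int m = 1"
    using bezout_int[of "int n" "int m"] assms(1) by (auto simp: coprime_iff_gcd_eq_1)
  have *: "y = (y ^ n) powi p * (y ^ m) powi q" if "y \<noteq> 0" for y :: 'a
  proof -
    have "y = y powi (p * int n + q * int m)" by (simp add: pq)
    also have "\<dots> = (y ^ n) powi p * (y ^ m) powi q"
      using that by (simp add: power_int_add mult.commute[of p] mult.commute[of q] power_int_mult)
    finally show ?thesis .
  qed
  show ?thesis using *[OF assms(2)] *[OF assms(3)] assms(4,5) by metis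
qed

lemma sgn_power: "sgn (x ^ k) = sgn x ^ k" for x :: complex
  by (induction k) (simp_all add: sgn_mult)

lemma sgn_cnj: "sgn (cnj z) = cnj (sgn z)"
  by (simp add: sgn_eq)

text \<open>The solutions form a coset of 2 pi Z, and a half-open interval of length 2 pi k contains
  exactly k of its points. Every root count below rests on this.\<close>

lemma card_cis_eq:
  fixes a :: real and \<kappa> :: complex
  assumes "cmod \<kappa> = 1"
  shows "finite {x. cis x = \<kappa> \<and> a < x \<and> x \<le> a + 2 * pi * real k}"
    and "card {x. cis x = \<kappa> \<and> a < x \<and> x \<le> a + 2 * pi * real k} = k"
proof -
  define K where "K = Arg \<kappa>"
  \<comment> \<open>Index of the last solution \<open>K + 2 * pi * p\<close> that does not exceed
    \<open>a\<close>; those in the interval are the next \<open>k\<close>.\<close>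
  define p where "p = \<lfloor>(a - K) / (2 * pi)\<rfloor>"
  have "\<kappa> \<noteq> 0" using assms by auto
  then have K: "cis K = \<kappa>"
    using assms unfolding K_def by (simp add: cis_Arg sgn_div_norm)
  have cis: "cis x = \<kappa> \<longleftrightarrow> (\<exists>j::int. x = K + 2 * pi * of_int j)" for x
  proof -
    have "cis x = cis K \<longleftrightarrow> sin x = sin K \<and> cos x = cos K" by (auto simp: complex_eq_iff)
    also have "\<dots> \<longleftrightarrow> (\<exists>j::int. x = K + 2 * pi * of_int j)"
      by (subst sin_cos_eq_iff) (auto simp: Ints_def algebra_simps)
    finally show ?thesis using K by simp
  qed
  have ival: "a < K + 2 * pi * of_int j \<and> K + 2 * pi * of_int j \<le> a + 2 * pi * real k
      \<longleftrightarrow> j \<in> {p + 1..p + int k}" for j :: int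
  proof -
    have "a < K + 2 * pi * of_int j \<longleftrightarrow> (a - K) / (2 * pi) < of_int j"
      by (simp add: field_simps)
    also have "\<dots> \<longleftrightarrow> p < j" unfolding p_def by linarith
    finally have 1: "a < K + 2 * pi * of_int j \<longleftrightarrow> p < j" .
    have "K + 2 * pi * of_int j \<le> a + 2 * pi * real k \<longleftrightarrow> of_int (j - int k) \<le> (a - K) / (2 * pi)"
      by (simp add: field_simps)
    also have "\<dots> \<longleftrightarrow> j - int k \<le> p" unfolding p_def by linarith
    finally show ?thesis using 1 by auto
  qed
  have *: "{x. cis x = \<kappa> \<and> a < x \<and> x \<le> a + 2 * pi * real k}
      = (\<lambda>j. K + 2 * pi * of_int j) ` {p + 1..p + int k}"
    unfolding cis image_def Bex_def ival[symmetric] by auto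
  show "finite {x. cis x = \<kappa> \<and> a < x \<and> x \<le> a + 2 * pi * real k}" unfolding * by simp
  show "card {x. cis x = \<kappa> \<and> a < x \<and> x \<le> a + 2 * pi * real k} = k"
    unfolding * by (subst card_image) (auto simp: inj_on_def)
qed

section \<open>Triangles with a side of length one\<close>

text \<open>Heron's formula: four times the area of the triangle with sides \<open>1\<close>, \<open>u\<close>, \<open>v\<close>.\<close>
definition heron :: "real \<Rightarrow> real \<Rightarrow> real" where
  "heron u v = sqrt ((u + v - 1) * (u + v + 1) * (u + 1 - v) * (v + 1 - u))"

lemma heron_commute: "heron u v = heron v u"
  by (simp add: heron_def algebra_simps)

lemma heron_pos:
  assumes "1 < u + v" "v < u + 1" "u < v + 1"
  shows "0 < heron u v"
proof -
  have "0 < u + v + 1" using assms by linarith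
  with assms show ?thesis by (simp add: heron_def)
qed

text \<open>Law of cosines: in the triangle with sides \<open>1\<close>, \<open>u\<close>,
  \<open>v\<close> this is the angle between \<open>1\<close> and \<open>u\<close>, opposite to
  \<open>v\<close>.\<close>

definition angle :: "real \<Rightarrow> real \<Rightarrow> real" where
  "angle u v = arccos ((1 + u\<^sup>2 - v\<^sup>2) / (2 * u))"

text \<open>After clearing the denominator the bounds read
  \<open>v\<^sup>2 \<le> (u + 1)\<^sup>2\<close> and \<open>(u - 1)\<^sup>2 \<le> v\<^sup>2\<close>,
  whose factors are the triangle inequalities.\<close>

lemma cos_bounds:
  fixes u v :: real
  assumes "0 < u" "1 \<le> u + v" "v \<le> u + 1" "u \<le> v + 1"
  shows "-1 \<le> (1 + u\<^sup>2 - v\<^sup>2) / (2 * u)" "(1 + u\<^sup>2 - v\<^sup>2) / (2 * u) \<le> 1"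
proof -
  have "0 \<le> (u + 1 - v) * (u + 1 + v)" "0 \<le> (v - u + 1) * (v + u - 1)"
    using assms by (auto intro!: mult_nonneg_nonneg)
  then show "-1 \<le> (1 + u\<^sup>2 - v\<^sup>2) / (2 * u)" "(1 + u\<^sup>2 - v\<^sup>2) / (2 * u) \<le> 1"
    using assms by (auto simp: field_simps power2_eq_square)
qed

lemma cos_bounds_strict:
  fixes u v :: real
  assumes "0 < u" "1 < u + v" "v < u + 1" "u < v + 1"
  shows "-1 < (1 + u\<^sup>2 - v\<^sup>2) / (2 * u)" "(1 + u\<^sup>2 - v\<^sup>2) / (2 * u) < 1"
proof -
  have "0 < (u + 1 - v) * (u + 1 + v)" "0 < (v - u + 1) * (v + u - 1)"
    using assms by (auto intro!: mult_pos_pos)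
  then show "-1 < (1 + u\<^sup>2 - v\<^sup>2) / (2 * u)" "(1 + u\<^sup>2 - v\<^sup>2) / (2 * u) < 1"
    using assms by (auto simp: field_simps power2_eq_square)
qed

lemma sqrt_cos_heron:
  assumes "0 < u"
  shows "sqrt (1 - ((1 + u\<^sup>2 - v\<^sup>2) / (2 * u))\<^sup>2) = heron u v / (2 * u)"
proof -
  have *: "1 - ((1 + u\<^sup>2 - v\<^sup>2) / (2 * u))\<^sup>2
    = ((u + v - 1) * (u + v + 1) * (u + 1 - v) * (v + 1 - u)) / (2 * u)\<^sup>2"
    using assms by (simp add: field_simps power2_eq_square)
  show ?thesis unfolding * real_sqrt_divide heron_def real_sqrt_abs using assms by simp
qed

lemma angle_facts:
  assumes "0 < u" "1 \<le> u + v" "v \<le> u + 1" "u \<le> v + 1"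
  shows "2 * u * cos (angle u v) = 1 + u\<^sup>2 - v\<^sup>2"
    and "2 * u * sin (angle u v) = heron u v"
    and "0 \<le> angle u v" and "angle u v \<le> pi"
  using cos_bounds[OF assms] assms(1)
  by (simp_all add: angle_def sin_arccos sqrt_cos_heron arccos_lbound arccos_ubound)

text \<open>Here \<open>p\<close> and \<open>q\<close> are logarithmic derivatives of the sides. The
  derivative of \<open>arccos\<close> contributes \<open>- 2 * u / heron u v\<close> by
  \<open>sqrt_cos_heron\<close>, and the factor \<open>2 * u\<close> cancels.\<close>

lemma DERIV_angle:
  assumes u: "(u has_real_derivative p * u t) (at t)"
    and v: "(v has_real_derivative q * v t) (at t)"
    and tri: "0 < u t" "1 < u t + v t" "v t < u t + 1" "u t < v t + 1"
  shows "((\<lambda>t. angle (u t) (v t)) has_real_derivative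
    (p - p * (u t)\<^sup>2 + (2 * q - p) * (v t)\<^sup>2) / heron (u t) (v t)) (at t)"
proof -
  have num: "((\<lambda>t. 1 + (u t)\<^sup>2 - (v t)\<^sup>2) has_real_derivative
      2 * p * (u t)\<^sup>2 - 2 * q * (v t)\<^sup>2) (at t)"
    by (rule DERIV_cong[OF DERIV_diff[OF DERIV_add[OF DERIV_const[of 1] DERIV_power[OF u, of 2]] DERIV_power[OF v, of 2]]])
      (simp add: power2_eq_square)
  have "((\<lambda>t. (1 + (u t)\<^sup>2 - (v t)\<^sup>2) / (2 * u t)) has_real_derivative
      (- p + p * (u t)\<^sup>2 - (2 * q - p) * (v t)\<^sup>2) / (2 * u t)) (at t)"
  proof (rule DERIV_cong[OF DERIV_divide[OF num DERIV_cmult[OF u, of 2]]])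
    show "2 * u t \<noteq> 0" using tri(1) by simp
    have "((2 * p * x\<^sup>2 - 2 * q * y\<^sup>2) * (2 * x) - (1 + x\<^sup>2 - y\<^sup>2) * (2 * (p * x))) / (2 * x * (2 * x))
      = (- p + p * x\<^sup>2 - (2 * q - p) * y\<^sup>2) / (2 * x)" if "0 < x" for x y
      using that by (simp add: divide_simps power2_eq_square) algebra
    from this[OF tri(1)] show "((2 * p * (u t)\<^sup>2 - 2 * q * (v t)\<^sup>2) * (2 * u t)
        - (1 + (u t)\<^sup>2 - (v t)\<^sup>2) * (2 * (p * u t))) / (2 * u t * (2 * u t))
      = (- p + p * (u t)\<^sup>2 - (2 * q - p) * (v t)\<^sup>2) / (2 * u t)" .
  qed
  from DERIV_chain2[OF DERIV_arccos[OF cos_bounds_strict[OF tri]] this]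
  have "((\<lambda>t. angle (u t) (v t)) has_real_derivative
      inverse (- (heron (u t) (v t) / (2 * u t)))
        * ((- p + p * (u t)\<^sup>2 - (2 * q - p) * (v t)\<^sup>2) / (2 * u t))) (at t)"
    unfolding sqrt_cos_heron[OF tri(1)] angle_def .
  then show ?thesis
    by (rule DERIV_cong) (use heron_pos[OF tri(2-4)] tri(1) in \<open>simp add: divide_simps\<close>)
qed

lemma continuous_on_angle:
  assumes "continuous_on X u" "continuous_on X v"
    and "\<And>t. t \<in> X \<Longrightarrow> 0 < u t \<and> 1 \<le> u t + v t \<and> v t \<le> u t + 1 \<and> u t \<le> v t + 1"
  shows "continuous_on X (\<lambda>t. angle (u t) (v t))"
  unfolding angle_def
proof (intro continuous_intros assms(1,2) ballI)
  show "2 * u t \<noteq> 0" if "t \<in> X" for t using assms(3)[OF that] by simp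
qed (use assms(3) cos_bounds in blast)+

section \<open>The shape function of a trinomial\<close>

locale trinomial =
  fixes n m :: nat and a b :: complex
  assumes coprime: "coprime n m" and m_pos: "0 < m" and m_less: "m < n"
    and a_nz: "a \<noteq> 0" and b_nz: "b \<noteq> 0"
begin

definition U :: "real \<Rightarrow> real" where "U t = cmod a * exp (real n * t)"
definition V :: "real \<Rightarrow> real" where "V t = cmod b * exp (real m * t)"

definition triangle :: "real \<Rightarrow> bool" where
  "triangle t \<longleftrightarrow> 1 \<le> U t + V t \<and> V t \<le> U t + 1 \<and> U t \<le> V t + 1"

definition \<phi> :: "real \<Rightarrow> real" where "\<phi> t = angle (U t) (V t)"
definition \<psi> :: "real \<Rightarrow> real" where "\<psi> t = angle (V t) (U t)"
definition D :: "real \<Rightarrow> real" where "D t = real m * \<phi> t - real n * \<psi> t"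

text \<open>In \<open>(a * z ^ n) ^ m * (b * cnj z ^ m) ^ n\<close> the direction of
  \<open>z\<close> cancels against that of \<open>cnj z\<close>; this is the direction that
  remains.\<close>

definition \<kappa> :: complex where "\<kappa> = sgn a ^ m * sgn b ^ n"

definition R :: "complex set" where "R = {z. a * z ^ n + b * cnj z ^ m = 1}"

text \<open>The derivative of \<open>V - U\<close> is \<open>m * V - n * U\<close>, so this marks
  the moduli up to the turning point of \<open>V - U\<close>, which is also that of
  \<open>D\<close>.\<close>

definition inner :: "real \<Rightarrow> bool" where "inner t \<longleftrightarrow> real n * U t \<le> real m * V t"

lemma U_pos [simp]: "0 < U t" and V_pos [simp]: "0 < V t"
  using a_nz b_nz by (auto simp: U_def V_def)

lemma UV_nonneg [simp]: "0 \<le> U t" "0 \<le> V t"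
  by (simp_all add: less_imp_le)

lemma n_pos: "0 < n" using m_less by simp

lemma cmod_kappa: "cmod \<kappa> = 1"
  using a_nz b_nz by (simp add: \<kappa>_def norm_mult norm_power norm_sgn)

lemma DERIV_U: "(U has_real_derivative real n * U t) (at t)"
  unfolding U_def[abs_def] by (auto intro!: derivative_eq_intros)

lemma DERIV_V: "(V has_real_derivative real m * V t) (at t)"
  unfolding V_def[abs_def] by (auto intro!: derivative_eq_intros)

text \<open>With the weights \<open>m\<close> and \<open>n\<close> the constant terms and the mixed
  coefficients \<open>n * m\<close> of the two angle derivatives cancel, which leaves a difference
  of squares whose sign is visible.\<close>

lemma DERIV_D:
  assumes "1 < U t + V t" "V t < U t + 1" "U t < V t + 1"
  shows "(D has_real_derivative
    2 * ((real m * V t)\<^sup>2 - (real n * U t)\<^sup>2) / heron (U t) (V t)) (at t)"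
proof -
  have 1: "(\<phi> has_real_derivative (real n - real n * (U t)\<^sup>2 + (2 * real m - real n) * (V t)\<^sup>2)
      / heron (U t) (V t)) (at t)"
    unfolding \<phi>_def[abs_def] using assms by (intro DERIV_angle DERIV_U DERIV_V) auto
  have 2: "(\<psi> has_real_derivative (real m - real m * (V t)\<^sup>2 + (2 * real n - real m) * (U t)\<^sup>2)
      / heron (U t) (V t)) (at t)"
    unfolding \<psi>_def[abs_def] using assms
    by (subst heron_commute, intro DERIV_angle DERIV_U DERIV_V) auto
  have "2 * ((real m * V t)\<^sup>2 - (real n * U t)\<^sup>2) =
    real m * (real n - real n * (U t)\<^sup>2 + (2 * real m - real n) * (V t)\<^sup>2)
    - real n * (real m - real m * (V t)\<^sup>2 + (2 * real n - real m) * (U t)\<^sup>2)"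
    by (simp add: power2_eq_square algebra_simps)
  then show ?thesis unfolding D_def[abs_def]
    using DERIV_diff[OF DERIV_cmult[OF 1, of "real m"] DERIV_cmult[OF 2, of "real n"]]
    by (simp add: diff_divide_distrib)
qed

lemma continuous_U: "continuous_on X U" and continuous_V: "continuous_on X V"
  unfolding U_def[abs_def] V_def[abs_def] by (auto intro!: continuous_intros)

lemma continuous_D:
  assumes "\<And>t. t \<in> X \<Longrightarrow> triangle t"
  shows "continuous_on X D"
  unfolding D_def[abs_def] \<phi>_def[abs_def] \<psi>_def[abs_def] using assms
  by (intro continuous_intros continuous_on_angle continuous_U continuous_V) (auto simp: triangle_def add.commute)

lemma angles:
  assumes "triangle t"
  shows "2 * U t * cos (\<phi> t) = 1 + (U t)\<^sup>2 - (V t)\<^sup>2" "2 * V t * cos (\<psi> t) = 1 + (V t)\<^sup>2 - (U t)\<^sup>2"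
    "U t * sin (\<phi> t) = V t * sin (\<psi> t)" "0 \<le> \<phi> t" "\<phi> t \<le> pi" "0 \<le> \<psi> t" "\<psi> t \<le> pi"
  using assms angle_facts[of "U t" "V t"] angle_facts[of "V t" "U t"] heron_commute[of "U t" "V t"]
  by (auto simp: triangle_def \<phi>_def \<psi>_def)

section \<open>Monotonicity on both sides of the turning point\<close>

lemma U_shift: "U s = U t * exp (real n * (s - t))" and V_shift: "V s = V t * exp (real m * (s - t))"
  by (simp_all add: U_def V_def flip: exp_add) (simp_all add: algebra_simps)

lemma U_mono: "s < t \<Longrightarrow> U s < U t" and V_mono: "s < t \<Longrightarrow> V s < V t"
  using a_nz b_nz n_pos m_pos by (auto simp: U_def V_def)

lemma exp_shift_less: "s < t \<Longrightarrow> exp (real n * (s - t)) < exp (real m * (s - t))"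
  using m_less by simp

text \<open>Going back from \<open>t\<close> to \<open>s\<close> shrinks \<open>U\<close> by a
  smaller factor than \<open>V\<close>, since \<open>m < n\<close>.\<close>

lemma inner_before:
  assumes "inner t" "s < t"
  shows "real n * U s < real m * V s"
proof -
  have "real n * U s = (real n * U t) * exp (real n * (s - t))"
    using U_shift[of s t] by simp
  also have "\<dots> \<le> (real m * V t) * exp (real n * (s - t))"
    using assms(1) by (intro mult_right_mono) (auto simp: inner_def)
  also have "\<dots> < (real m * V t) * exp (real m * (s - t))"
    using m_pos by (intro mult_strict_left_mono exp_shift_less assms(2)) auto
  also have "\<dots> = real m * V s"
    using V_shift[of s t] by simp
  finally show ?thesis .
qed

lemma outer_after:
  assumes "real m * V s \<le> real n * U s" "s < t"
  shows "real m * V t < real n * U t"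
  using inner_before[of t s] assms by (force simp: inner_def)

lemma V_minus_U_inner:
  assumes "inner t" "s < t"
  shows "V s - U s < V t - U t"
proof (rule DERIV_pos_imp_increasing_open[OF assms(2)])
  fix x assume "s < x" "x < t"
  then show "\<exists>y. ((\<lambda>x. V x - U x) has_real_derivative y) (at x) \<and> y > 0"
    using inner_before[OF assms(1), of x] DERIV_diff[OF DERIV_V DERIV_U, of x]
    by (intro exI[of _ "real m * V x - real n * U x"]) auto
qed (intro continuous_intros continuous_U continuous_V)

lemma V_minus_U_outer:
  assumes "real m * V s \<le> real n * U s" "s < t"
  shows "V t - U t < V s - U s"
proof (rule DERIV_neg_imp_decreasing_open[OF assms(2)])
  fix x assume "s < x" "x < t"
  then show "\<exists>y. ((\<lambda>x. V x - U x) has_real_derivative y) (at x) \<and> y < 0"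
    using outer_after[OF assms(1), of x] DERIV_diff[OF DERIV_V DERIV_U, of x]
    by (intro exI[of _ "real m * V x - real n * U x"]) auto
qed (intro continuous_intros continuous_U continuous_V)

lemma inner_U_less_V:
  assumes "inner t"
  shows "U t < V t"
proof -
  have "real m * U t < real n * U t" using m_less by (intro mult_strict_right_mono) auto
  also have "\<dots> \<le> real m * V t" using assms by (simp add: inner_def)
  finally have "real m * U t < real m * V t" .
  then show ?thesis using m_pos by simp
qed

lemma inner_downward: "inner t \<Longrightarrow> s \<le> t \<Longrightarrow> inner s"
  using inner_before[of t s] by (cases "s = t") (auto simp: inner_def)

text \<open>\<open>U + V\<close> has grown since \<open>s\<close>, \<open>V - U\<close> still grows
  until \<open>t\<close>, and \<open>U < V\<close> holds on the inner side; each fact makes one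
  inequality strict.\<close>

lemma strict_triangle_inner:
  assumes "triangle s" "triangle t" "inner t" "s < x" "x < t"
  shows "1 < U x + V x" "V x < U x + 1" "U x < V x + 1"
  using assms(1,2) U_mono[OF assms(4)] V_mono[OF assms(4)] V_minus_U_inner[OF assms(3,5)]
    inner_U_less_V[OF inner_downward[OF assms(3), of x]] assms(5)
  by (auto simp: triangle_def)

text \<open>\<open>V - U\<close> now decreases, so its value at \<open>s\<close> bounds it above and
  its value at \<open>t\<close> bounds it below.\<close>

lemma strict_triangle_outer:
  assumes "triangle s" "triangle t" "real m * V s \<le> real n * U s" "s < x" "x < t"
  shows "1 < U x + V x" "V x < U x + 1" "U x < V x + 1"
  using assms(1,2) U_mono[OF assms(4)] V_mono[OF assms(4)] V_minus_U_outer[OF assms(3,4)]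
    V_minus_U_outer[of x t] outer_after[OF assms(3,4)] assms(5)
  by (auto simp: triangle_def)

lemma triangle_between_inner:
  "triangle s \<Longrightarrow> triangle t \<Longrightarrow> inner t \<Longrightarrow> s \<le> x \<Longrightarrow> x \<le> t \<Longrightarrow> triangle x"
  using strict_triangle_inner[of s t x] by (cases "x = s \<or> x = t") (force simp: triangle_def)+

lemma triangle_between_outer:
  "triangle s \<Longrightarrow> triangle t \<Longrightarrow> real m * V s \<le> real n * U s \<Longrightarrow> s \<le> x \<Longrightarrow> x \<le> t \<Longrightarrow> triangle x"
  using strict_triangle_outer[of s t x] by (cases "x = s \<or> x = t") (force simp: triangle_def)+

text \<open>Strictly between \<open>s\<close> and \<open>t\<close> the triangle is nondegenerate, so
  \<open>DERIV_D\<close> applies. The endpoints may be degenerate, but continuity suffices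
  there.\<close>

lemma D_inner_mono:
  assumes "triangle s" "triangle t" "inner t" "s < t"
  shows "D s < D t"
proof (rule DERIV_pos_imp_increasing_open[OF assms(4)])
  fix x assume x: "s < x" "x < t"
  note strict = strict_triangle_inner[OF assms(1-3) x]
  have "(real n * U x)\<^sup>2 < (real m * V x)\<^sup>2"
    using inner_before[OF assms(3) x(2)] by (intro power_strict_mono) auto
  then show "\<exists>y. (D has_real_derivative y) (at x) \<and> y > 0"
    using DERIV_D[OF strict] heron_pos[OF strict] by (intro exI conjI) (assumption, simp)
next
  show "continuous_on {s..t} D"
    using triangle_between_inner[OF assms(1-3)] by (intro continuous_D) simp
qed

lemma D_outer_antimono:
  assumes "triangle s" "triangle t" "real m * V s \<le> real n * U s" "s < t"
  shows "D t < D s"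
proof (rule DERIV_neg_imp_decreasing_open[OF assms(4)])
  fix x assume x: "s < x" "x < t"
  note strict = strict_triangle_outer[OF assms(1-3) x]
  have "(real m * V x)\<^sup>2 < (real n * U x)\<^sup>2"
    using outer_after[OF assms(3) x(1)] by (intro power_strict_mono) auto
  then show "\<exists>y. (D has_real_derivative y) (at x) \<and> y < 0"
    using DERIV_D[OF strict] heron_pos[OF strict]
    by (intro exI conjI) (assumption, simp add: divide_less_0_iff)
next
  show "continuous_on {s..t} D"
    using triangle_between_outer[OF assms(1-3)] by (intro continuous_D) simp
qed

section \<open>Degenerate triangles and the range of D\<close>

lemma ex_small:
  "\<exists>s\<le>t. s \<le> 0 \<and> U s + V s \<le> 1"
proof -
  define C where "C = cmod a + cmod b"
  have C: "C > 0" using a_nz by (simp add: C_def add_pos_nonneg)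
  \<comment> \<open>\<open>s \<le> 0\<close> bounds both exponentials by \<open>exp s\<close>, and
    \<open>s \<le> - ln C\<close> makes \<open>C * exp s\<close> at most \<open>1\<close>.\<close>
  define s where "s = min t (min 0 (- ln C))"
  have s: "s \<le> t" "s \<le> 0" "s \<le> - ln C" by (auto simp: s_def)
  have *: "exp (real k * s) \<le> exp s" if "0 < k" for k
  proof -
    have "real k * s \<le> 1 * s" using s(2) that by (intro mult_right_mono_neg) auto
    then show ?thesis by simp
  qed
  have "U s + V s \<le> C * exp s"
    unfolding U_def V_def C_def distrib_right
    using n_pos m_pos by (intro add_mono mult_left_mono *) auto
  also have "\<dots> \<le> C * exp (- ln C)" using s(3) C by (intro mult_left_mono) auto
  also have "\<dots> = 1" using C by (simp add: exp_minus)
  finally show ?thesis using s by blast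
qed

lemma ex_U_plus_V_eq_1:
  assumes "1 \<le> U t + V t"
  shows "\<exists>s\<le>t. U s + V s = 1"
proof -
  obtain s where s: "s \<le> t" "U s + V s \<le> 1" using ex_small by blast
  have "\<exists>x. s \<le> x \<and> x \<le> t \<and> U x + V x = 1"
    using s assms by (intro IVT' continuous_intros continuous_U continuous_V) auto
  then show ?thesis by blast
qed

text \<open>The three ways to flatten the triangle; they give \<open>D\<close> the values
  \<open>0\<close>, \<open>m * pi\<close> and \<open>- n * pi\<close>.\<close>

lemma degenerate:
  shows "U t + V t = 1 \<Longrightarrow> triangle t \<and> \<phi> t = 0 \<and> \<psi> t = 0"
    and "V t = U t + 1 \<Longrightarrow> triangle t \<and> \<phi> t = pi \<and> \<psi> t = 0"
    and "U t = V t + 1 \<Longrightarrow> triangle t \<and> \<phi> t = 0 \<and> \<psi> t = pi"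
proof -
  have 1: "angle u v = 0" if "0 < u" "u + v = 1 \<or> u = v + 1" for u v
  proof -
    have "1 + u\<^sup>2 - v\<^sup>2 = 2 * u"
      using that(2)
    proof
      assume "u + v = 1"
      then have v: "v = 1 - u" by linarith
      show ?thesis unfolding v by (simp add: power2_eq_square algebra_simps)
    next
      assume "u = v + 1"
      then show ?thesis by (simp add: power2_eq_square algebra_simps)
    qed
    then show ?thesis using that(1) by (simp add: angle_def)
  qed
  have 2: "angle u (u + 1) = pi" if "0 < u" for u
  proof -
    have "1 + u\<^sup>2 - (u + 1)\<^sup>2 = - (2 * u)" by (simp add: power2_eq_square algebra_simps)
    then show ?thesis unfolding angle_def using that by simp
  qed
  have tri: "triangle t" if "U t + V t = 1 \<or> V t = U t + 1 \<or> U t = V t + 1"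
    using that U_pos[of t] V_pos[of t] unfolding triangle_def by linarith
  show "U t + V t = 1 \<Longrightarrow> triangle t \<and> \<phi> t = 0 \<and> \<psi> t = 0"
    using tri 1[of "U t" "V t"] 1[of "V t" "U t"] by (simp add: \<phi>_def \<psi>_def add.commute)
  show "V t = U t + 1 \<Longrightarrow> triangle t \<and> \<phi> t = pi \<and> \<psi> t = 0"
    using tri 1[OF V_pos, of t "U t"] 2[of "U t"] by (simp add: \<phi>_def \<psi>_def)
  show "U t = V t + 1 \<Longrightarrow> triangle t \<and> \<phi> t = 0 \<and> \<psi> t = pi"
    using tri 1[OF U_pos, of t "V t"] 2[of "V t"] by (simp add: \<phi>_def \<psi>_def)
qed

text \<open>\<open>D\<close> vanishes at some \<open>s \<le> t\<close> with
  \<open>U s + V s = 1\<close> and increases from there, so it can vanish at \<open>t\<close> only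
  if \<open>t = s\<close>.\<close>

lemma D_inner_nonneg:
  assumes "triangle t" "inner t"
  shows "0 \<le> D t" and "D t = 0 \<Longrightarrow> \<phi> t = 0 \<and> \<psi> t = 0"
proof -
  obtain s where s: "s \<le> t" "U s + V s = 1"
    using ex_U_plus_V_eq_1[of t] assms(1) by (auto simp: triangle_def)
  have Ds: "D s = 0" using degenerate(1)[OF s(2)] by (simp add: D_def)
  have *: "0 < D t \<or> t = s"
    using D_inner_mono[of s t] degenerate(1)[OF s(2)] assms s(1) Ds by force
  then show "0 \<le> D t" using Ds by auto
  show "D t = 0 \<Longrightarrow> \<phi> t = 0 \<and> \<psi> t = 0"
    using * degenerate(1)[OF s(2)] by auto
qed

lemma D_le:
  assumes "triangle t"
  shows "D t \<le> real m * pi" and "D t = real m * pi \<Longrightarrow> \<phi> t = pi"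
proof -
  have 1: "0 \<le> real n * \<psi> t" "real m * \<phi> t \<le> real m * pi"
    using angles[OF assms] by (auto intro: mult_left_mono)
  then show "D t \<le> real m * pi" by (simp add: D_def)
  assume "D t = real m * pi"
  then have "real m * \<phi> t = real m * pi" using 1 unfolding D_def by linarith
  then show "\<phi> t = pi" using m_pos by simp
qed

lemma D_ge:
  assumes "triangle t"
  shows "- real n * pi \<le> D t" and "D t = - real n * pi \<Longrightarrow> \<phi> t = 0"
proof -
  have 1: "0 \<le> real m * \<phi> t" "real n * \<psi> t \<le> real n * pi"
    using angles[OF assms] by (auto intro: mult_left_mono)
  then show "- real n * pi \<le> D t" by (simp add: D_def)
  assume "D t = - real n * pi"
  then have "real m * \<phi> t = 0" using 1 unfolding D_def by linarith
  then show "\<phi> t = 0" using m_pos by simp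
qed

text \<open>In a flat triangle both angles are multiples of pi. Used contrapositively: a non-real
  \<open>\<kappa>\<close> excludes flat triangles.\<close>

lemma sin_D_eq_0:
  assumes "triangle t" "sin (\<phi> t) = 0"
  shows "sin (D t) = 0"
proof -
  have "sin (\<psi> t) = 0" using angles(3)[OF assms(1)] assms(2) V_pos[of t] by auto
  with assms(2) obtain i j :: int where "\<phi> t = of_int i * pi" "\<psi> t = of_int j * pi"
    unfolding sin_zero_iff_int2 by blast
  then have "D t = of_int (int m * i - int n * j) * pi" by (simp add: D_def algebra_simps)
  then show ?thesis unfolding sin_zero_iff_int2 by blast
qed

section \<open>Roots as oriented triangles\<close>

definition T :: "complex \<Rightarrow> real" where "T z = ln (cmod z)"

text \<open>The orientation of the triangle. For degenerate triangles both signs would describe the root;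
  the choice makes the codes below fall into half-open intervals.\<close>
definition sg :: "complex \<Rightarrow> real" where
  "sg z = (if Im (a * z ^ n) \<noteq> 0 then sgn (Im (a * z ^ n))
           else if D (T z) = - real n * pi then -1 else 1)"

lemma sg_cases: "sg z = 1 \<or> sg z = -1"
  by (auto simp: sg_def sgn_if)

lemma root_norm:
  assumes "z \<in> R"
  shows "z \<noteq> 0" "cmod (a * z ^ n) = U (T z)" "cmod (b * cnj z ^ m) = V (T z)"
proof -
  show z: "z \<noteq> 0" using assms n_pos m_pos by (auto simp: R_def zero_power)
  then have e: "cmod z = exp (T z)" by (simp add: T_def)
  show "cmod (a * z ^ n) = U (T z)" "cmod (b * cnj z ^ m) = V (T z)"
    by (simp_all add: norm_mult norm_power U_def V_def e exp_of_nat_mult)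
qed

lemma root_triangle:
  assumes "z \<in> R"
  shows "triangle (T z)"
proof -
  have s: "a * z ^ n + b * cnj z ^ m = 1" using assms by (simp add: R_def)
  let ?x = "a * z ^ n" and ?y = "b * cnj z ^ m"
  have "cmod 1 \<le> cmod ?x + cmod ?y" using norm_triangle_ineq[of ?x ?y] s by simp
  moreover have "cmod ?y \<le> 1 + cmod ?x"
    using norm_triangle_ineq4[of 1 ?x] s by (metis add_diff_cancel_left' norm_one)
  moreover have "cmod ?x \<le> 1 + cmod ?y"
    using norm_triangle_ineq4[of 1 ?y] s by (metis add_diff_cancel_right' norm_one)
  ultimately show ?thesis using root_norm[OF assms] by (simp add: triangle_def add.commute)
qed

text \<open>The moduli of \<open>x\<close> and \<open>1 - x\<close> determine \<open>Re x\<close>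
  and the absolute value of \<open>Im x\<close>; \<open>sg\<close> supplies the missing sign. The
  summands have opposite imaginary parts, hence the opposite signs in \<open>cis\<close>.\<close>

lemma root_polar:
  assumes "z \<in> R"
  shows "a * z ^ n = of_real (U (T z)) * cis (sg z * \<phi> (T z))"
    and "b * cnj z ^ m = of_real (V (T z)) * cis (- sg z * \<psi> (T z))"
proof -
  define t where "t = T z"
  define x where "x = a * z ^ n"
  define y where "y = b * cnj z ^ m"
  have y: "y = 1 - x" using assms by (simp add: R_def x_def y_def algebra_simps)
  have tri: "triangle t" using root_triangle[OF assms] by (simp add: t_def)
  have nx: "(Re x)\<^sup>2 + (Im x)\<^sup>2 = (U t)\<^sup>2" and ny: "(Re y)\<^sup>2 + (Im y)\<^sup>2 = (V t)\<^sup>2"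
    using root_norm[OF assms] unfolding cmod_power2[symmetric] x_def y_def t_def by simp_all
  have Re: "Re x = U t * cos (\<phi> t)" "Re y = V t * cos (\<psi> t)"
    using angles(1,2)[OF tri] nx ny by (simp_all add: y power2_eq_square algebra_simps)
  have "(Im x)\<^sup>2 = (U t * sin (\<phi> t))\<^sup>2"
    using nx by (simp add: Re power_mult_distrib sin_squared_eq algebra_simps)
  moreover have "0 \<le> U t * sin (\<phi> t)"
    using angles(4,5)[OF tri] U_pos[of t] by (intro mult_nonneg_nonneg sin_ge_zero) auto
  ultimately have absIm: "\<bar>Im x\<bar> = U t * sin (\<phi> t)"
    unfolding power2_eq_iff by linarith
  have "sg z = (if Im x \<noteq> 0 then sgn (Im x) else if D t = - real n * pi then -1 else 1)"
    by (simp only: sg_def x_def t_def)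
  then have "Im x = sg z * \<bar>Im x\<bar>" by (simp add: sgn_mult_abs)
  then have Im: "Im x = sg z * (U t * sin (\<phi> t))" unfolding absIm .
  have trig: "cos (sg z * r) = cos r" "sin (sg z * r) = sg z * sin r"
    "cos (- sg z * r) = cos r" "sin (- sg z * r) = - sg z * sin r" for r
    using sg_cases[of z] by auto
  have "x = of_real (U t) * cis (sg z * \<phi> t)"
    by (simp add: complex_eq_iff Re Im trig)
  moreover have "y = of_real (V t) * cis (- sg z * \<psi> t)"
    using angles(3)[OF tri] Re(2) by (simp add: complex_eq_iff trig del: mult_minus_left) (simp add: y Im)
  ultimately show "a * z ^ n = of_real (U (T z)) * cis (sg z * \<phi> (T z))"
    and "b * cnj z ^ m = of_real (V (T z)) * cis (- sg z * \<psi> (T z))"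
    by (simp_all add: x_def y_def t_def)
qed

lemma Im_root:
  assumes "z \<in> R"
  shows "Im (a * z ^ n) = sg z * (U (T z) * sin (\<phi> (T z)))"
  using root_polar(1)[OF assms] sg_cases[of z] by auto

text \<open>Normalise both polar forms, take the powers \<open>m\<close> and \<open>n\<close> and
  multiply: the direction \<open>e\<close> of \<open>z\<close> occurs only through
  \<open>e * cnj e = 1\<close>.\<close>

lemma cis_code:
  assumes "z \<in> R"
  shows "cis (sg z * D (T z)) = \<kappa>"
proof -
  define e where "e = sgn z"
  have e: "e * cnj e = 1"
    using root_norm(1)[OF assms] by (simp add: e_def norm_sgn flip: complex_norm_square)
  have 1: "cis (sg z * \<phi> (T z)) = sgn a * e ^ n"
    using arg_cong[OF root_polar(1)[OF assms], of sgn] U_pos[of "T z"]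
    by (simp add: sgn_mult sgn_power e_def sgn_of_real)
  have 2: "cis (- sg z * \<psi> (T z)) = sgn b * cnj e ^ m"
    using arg_cong[OF root_polar(2)[OF assms], of sgn] V_pos[of "T z"]
    by (simp add: sgn_mult sgn_power e_def sgn_of_real sgn_cnj)
  have "cis (sg z * D (T z)) = cis (sg z * \<phi> (T z)) ^ m * cis (- sg z * \<psi> (T z)) ^ n"
    by (simp add: DeMoivre cis_mult D_def algebra_simps)
  also have "\<dots> = \<kappa> * (e * cnj e) ^ (n * m)"
    unfolding 1 2 by (simp add: \<kappa>_def power_mult_distrib power_mult[symmetric] mult.commute)
  finally show ?thesis by (simp add: e)
qed

text \<open>The polar forms determine \<open>z ^ n\<close> and \<open>z ^ m\<close>, hence
  \<open>z\<close> by coprimality. If both angles vanish, the orientation drops out of them.\<close>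

lemma root_eqI:
  assumes "z \<in> R" "w \<in> R" "T z = T w"
    and "sg z = sg w \<or> (\<phi> (T z) = 0 \<and> \<psi> (T z) = 0)"
  shows "z = w"
proof -
  have "a * z ^ n = a * w ^ n" "b * cnj z ^ m = b * cnj w ^ m"
    using root_polar[OF assms(1)] root_polar[OF assms(2)] assms(3,4) by auto
  then have "z ^ n = w ^ n" "cnj (z ^ m) = cnj (w ^ m)"
    using a_nz b_nz by simp_all
  then show ?thesis
    using coprime_powers_inj[OF coprime root_norm(1)[OF assms(1)] root_norm(1)[OF assms(2)]]
    by (simp only: complex_cnj_cancel_iff)
qed

text \<open>Converse of \<open>cis_code\<close>: the code condition is exactly the compatibility
  \<open>x ^ m = w ^ n\<close> of the values prescribed for the two powers of the direction of
  \<open>z\<close>.\<close>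

lemma ex_root:
  assumes tri: "triangle t" and \<epsilon>: "\<epsilon> = 1 \<or> \<epsilon> = -1"
    and code: "cis (\<epsilon> * D t) = \<kappa>" and nondeg: "sin (\<phi> t) \<noteq> 0"
  shows "\<exists>z\<in>R. T z = t \<and> sg z = \<epsilon>"
proof -
  have unit: "sgn a * cnj (sgn a) = 1" "sgn b * cnj (sgn b) = 1"
    using a_nz b_nz by (simp_all add: norm_sgn flip: complex_norm_square)
  define x where "x = cis (\<epsilon> * \<phi> t) * cnj (sgn a)"
  define w where "w = cis (\<epsilon> * \<psi> t) * sgn b"
  have nz: "x \<noteq> 0" "w \<noteq> 0" using a_nz b_nz by (auto simp: x_def w_def sgn_zero_iff)
  have "cis (\<epsilon> * \<phi> t) ^ m = cis (\<epsilon> * \<psi> t) ^ n * cis (\<epsilon> * D t)"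
    by (simp add: DeMoivre cis_mult D_def algebra_simps)
  then have "x ^ m = cis (\<epsilon> * \<psi> t) ^ n * \<kappa> * cnj (sgn a) ^ m"
    by (simp add: x_def power_mult_distrib code)
  also have "\<dots> = cis (\<epsilon> * \<psi> t) ^ n * sgn b ^ n * (sgn a * cnj (sgn a)) ^ m"
    by (simp add: \<kappa>_def power_mult_distrib)
  finally have "x ^ m = w ^ n" by (simp add: unit w_def power_mult_distrib)
  then obtain e where e: "e ^ n = x" "e ^ m = w"
    using ex_common_root[OF coprime nz] by blast
  have "cmod e ^ n = 1" using e(1) a_nz by (simp add: x_def norm_mult norm_sgn flip: norm_power)
  then have ne: "cmod e = 1" using n_pos power_eq_imp_eq_base[of "cmod e" n 1] by simp
  define z where "z = of_real (exp t) * e"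
  have T: "T z = t" by (simp add: T_def z_def norm_mult ne)
  have 1: "a * z ^ n = of_real (U t) * cis (\<epsilon> * \<phi> t)"
  proof -
    have "a * z ^ n = of_real (cmod a) * (sgn a * cnj (sgn a)) * of_real (exp t ^ n) * cis (\<epsilon> * \<phi> t)"
      using a_nz by (simp add: z_def power_mult_distrib e x_def sgn_eq)
    then show ?thesis by (simp add: unit U_def exp_of_nat_mult)
  qed
  have 2: "b * cnj z ^ m = of_real (V t) * cis (- \<epsilon> * \<psi> t)"
  proof -
    have "cnj e ^ m = cnj w" using e(2) by (metis complex_cnj_power)
    then have "b * cnj z ^ m = of_real (cmod b) * (sgn b * cnj (sgn b)) * of_real (exp t ^ m) * cis (- \<epsilon> * \<psi> t)"
      using b_nz by (simp add: z_def power_mult_distrib w_def sgn_eq cis_cnj)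
    then show ?thesis by (simp add: unit V_def exp_of_nat_mult)
  qed
  have trig: "cos (\<epsilon> * r) = cos r" "sin (\<epsilon> * r) = \<epsilon> * sin r" for r
    using \<epsilon> by auto
  have "U t * cos (\<phi> t) + V t * cos (\<psi> t) = 1" using angles(1,2)[OF tri] by simp
  then have "a * z ^ n + b * cnj z ^ m = 1"
    unfolding 1 2 using angles(3)[OF tri] by (simp add: complex_eq_iff trig)
  then have R: "z \<in> R" by (simp add: R_def)
  \<comment> \<open>Nondegeneracy makes the imaginary part nonzero, so that \<open>sg\<close> reads
    off \<open>\<epsilon>\<close> instead of using its convention for real values.\<close>
  have "0 < sin (\<phi> t)" using nondeg angles(4,5)[OF tri] by (simp add: less_le sin_ge_zero)
  then have "0 < U t * sin (\<phi> t)" by simp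
  moreover have "Im (a * z ^ n) = \<epsilon> * (U t * sin (\<phi> t))" unfolding 1 by (simp add: trig)
  ultimately have "sg z = \<epsilon>" using \<epsilon> by (auto simp: sg_def)
  with R T show ?thesis by blast
qed

section \<open>Counting roots\<close>

text \<open>The signed values of \<open>D\<close> lie in an interval of length
  \<open>2 * pi * m\<close> and separate the roots. Both signs give the same code only at
  \<open>D = 0\<close>, where the two oriented triangles coincide.\<close>

lemma card_inner_roots:
  "finite {z \<in> R. inner (T z)}" (is "finite ?A")
  "card {z \<in> R. inner (T z)} \<le> m"
proof -
  define code where "code z = sg z * D (T z)" for z
  let ?B = "{x. cis x = \<kappa> \<and> - real m * pi < x \<and> x \<le> - real m * pi + 2 * pi * real m}"
  have inj: "inj_on code ?A"
  proof (rule inj_onI)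
    fix z w assume "z \<in> ?A" "w \<in> ?A" and eq: "code z = code w"
    then have z: "z \<in> R" "triangle (T z)" "inner (T z)" and w: "w \<in> R" "triangle (T w)" "inner (T w)"
      by (auto intro: root_triangle)
    note D = D_inner_nonneg[OF z(2,3)] D_inner_nonneg[OF w(2,3)]
    have "D (T z) = D (T w)"
      using eq D sg_cases[of z] sg_cases[of w] unfolding code_def by force
    then have T: "T z = T w"
      using D_inner_mono[OF z(2) w(2,3)] D_inner_mono[OF w(2) z(2,3)]
      by (cases "T z" "T w" rule: linorder_cases) auto
    then have "sg z = sg w \<or> D (T z) = 0" using eq by (auto simp: code_def)
    then show "z = w" using root_eqI[OF z(1) w(1) T] D(2) by blast
  qed
  have sub: "code ` ?A \<subseteq> ?B"
  proof
    fix x assume "x \<in> code ` ?A"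
    then obtain z where z: "z \<in> R" "inner (T z)" and x: "x = code z" by blast
    have tri: "triangle (T z)" using root_triangle[OF z(1)] .
    have D: "0 \<le> D (T z)" "D (T z) \<le> real m * pi"
      using D_inner_nonneg[OF tri z(2)] D_le[OF tri] by auto
    \<comment> \<open>Excludes the left endpoint of the interval: at the maximum of \<open>D\<close>
      the triangle is flat and the convention in \<open>sg\<close> chooses \<open>1\<close>.\<close>
    have "sg z = 1" if "D (T z) = real m * pi"
    proof -
      have "Im (a * z ^ n) = 0" using D_le(2)[OF tri that] Im_root[OF z(1)] by simp
      moreover have "- real n * pi < D (T z)"
        using D(1) n_pos by (intro less_le_trans[OF _ D(1)]) simp
      ultimately show ?thesis unfolding sg_def by simp
    qed
    moreover have "0 < real m * pi" using m_pos by simp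
    ultimately have "- (real m * pi) < x \<and> x \<le> real m * pi"
      using D sg_cases[of z] unfolding x code_def by force
    then show "x \<in> ?B" using cis_code[OF z(1)] by (simp add: x code_def mult.commute)
  qed
  show "finite ?A" using inj_on_finite[OF inj sub] card_cis_eq(1)[OF cmod_kappa] by blast
  show "card ?A \<le> m"
    using card_inj_on_le[OF inj sub card_cis_eq(1)[OF cmod_kappa]] unfolding card_cis_eq(2)[OF cmod_kappa] .
qed

text \<open>The reflection at \<open>m \<pi>\<close> moves the values for negative orientation to the interval above
  those for positive orientation, so that one set of consecutive solutions of \<open>cis x = \<kappa>\<close> counts both.\<close>
definition outer_code :: "complex \<Rightarrow> real" where
  "outer_code z = (if sg z = 1 then D (T z) else 2 * (real m * pi) - D (T z))"

text \<open>Extreme values of \<open>D\<close> force flat triangles, where the convention in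
  \<open>sg\<close> assigns \<open>-1\<close> to the minimum and \<open>1\<close> to the
  maximum.\<close>

lemma outer_code_bounds:
  assumes "z \<in> R"
  shows "sg z = 1 \<Longrightarrow> - real n * pi < D (T z)" "sg z = -1 \<Longrightarrow> D (T z) < real m * pi"
proof -
  have tri: "triangle (T z)" using root_triangle[OF assms] .
  have "sg z = -1" if "D (T z) = - real n * pi"
    using D_ge(2)[OF tri that] Im_root[OF assms] that unfolding sg_def by simp
  then show "sg z = 1 \<Longrightarrow> - real n * pi < D (T z)" using D_ge(1)[OF tri] by force
  have "sg z = 1" if "D (T z) = real m * pi"
  proof -
    have "Im (a * z ^ n) = 0" using D_le(2)[OF tri that] Im_root[OF assms] by simp
    moreover have "- real n * pi < D (T z)"
      unfolding that using m_pos n_pos by (simp add: less_trans[of _ 0])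
    ultimately show ?thesis unfolding sg_def by simp
  qed
  then show "sg z = -1 \<Longrightarrow> D (T z) < real m * pi" using D_le(1)[OF tri] by force
qed

lemma cis_2_mult_pi_minus: "cis (2 * (real k * pi) - x) = cis (- x)"
proof -
  have "2 * (real k * pi) - x = of_nat k * (2 * pi) + - x" by simp
  then have "cis (2 * (real k * pi) - x) = cis (2 * pi) ^ k * cis (- x)"
    by (metis DeMoivre cis_mult)
  then show ?thesis by simp
qed

lemma card_outer_roots:
  "finite {z \<in> R. \<not> inner (T z)}" (is "finite ?A")
  "card {z \<in> R. \<not> inner (T z)} \<le> n + m"
proof -
  let ?B = "{x. cis x = \<kappa> \<and> - real n * pi < x \<and> x \<le> - real n * pi + 2 * pi * real (n + m)}"
  have inj: "inj_on outer_code ?A"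
  proof (rule inj_onI)
    fix z w assume "z \<in> ?A" "w \<in> ?A" and eq: "outer_code z = outer_code w"
    then have z: "z \<in> R" "triangle (T z)" "\<not> inner (T z)" and w: "w \<in> R" "triangle (T w)" "\<not> inner (T w)"
      by (auto intro: root_triangle)
    define p where "p = real m * pi"
    \<comment> \<open>Codes for positive orientation are at most \<open>m * pi\<close>, the
      reflected ones exceed it, so a code determines the orientation.\<close>
    have "D (T z) = D (T w) \<and> sg z = sg w"
      using eq sg_cases[of z] sg_cases[of w] D_le(1)[OF z(2), folded p_def] D_le(1)[OF w(2), folded p_def]
        outer_code_bounds(2)[OF z(1), folded p_def] outer_code_bounds(2)[OF w(1), folded p_def]
      unfolding outer_code_def p_def[symmetric] by (auto split: if_splits)
    moreover from this have T: "T z = T w"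
      using D_outer_antimono[OF z(2) w(2)] D_outer_antimono[OF w(2) z(2)] z(3) w(3)
      by (cases "T z" "T w" rule: linorder_cases) (auto simp: inner_def)
    ultimately show "z = w" using root_eqI[OF z(1) w(1) T] by blast
  qed
  have sub: "outer_code ` ?A \<subseteq> ?B"
  proof
    fix x assume "x \<in> outer_code ` ?A"
    then obtain z where z: "z \<in> R" and x: "x = outer_code z" by blast
    have tri: "triangle (T z)" using root_triangle[OF z] .
    have cis: "cis x = \<kappa>"
      using cis_code[OF z] sg_cases[of z] by (auto simp: x outer_code_def cis_2_mult_pi_minus)
    have pos: "0 < real m * pi" "0 < real n * pi" using m_pos n_pos by auto
    have "- (real n * pi) < x \<and> x \<le> real n * pi + 2 * (real m * pi)"
      using sg_cases[of z] outer_code_bounds[OF z] D_le(1)[OF tri] D_ge(1)[OF tri] pos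
      unfolding x outer_code_def by auto
    then show "x \<in> ?B" using cis by (simp add: algebra_simps)
  qed
  show "finite ?A" using inj_on_finite[OF inj sub] card_cis_eq(1)[OF cmod_kappa] by blast
  show "card ?A \<le> n + m"
    using card_inj_on_le[OF inj sub card_cis_eq(1)[OF cmod_kappa]] unfolding card_cis_eq(2)[OF cmod_kappa] .
qed

lemma roots_split: "R = {z \<in> R. inner (T z)} \<union> {z \<in> R. \<not> inner (T z)}" by blast

lemma card_roots_le: "finite R" "card R \<le> n + 2 * m"
proof -
  show "finite R" by (subst roots_split) (simp only: finite_Un card_inner_roots card_outer_roots)
  have "card R \<le> card {z \<in> R. inner (T z)} + card {z \<in> R. \<not> inner (T z)}"
    by (subst (1) roots_split) (rule card_Un_le)
  then show "card R \<le> n + 2 * m" using card_inner_roots(2) card_outer_roots(2) by linarith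
qed

text \<open>Sharpness. The moduli put the turning point at \<open>t = 0\<close> with
  \<open>V 0 - U 0 = 2 * (n - m)\<close>, so \<open>V = U + 1\<close> occurs on both sides of it and
  \<open>D\<close> covers its full range twice over. As \<open>\<kappa>\<close> is not real, every
  code in the two intervals comes from a nondegenerate triangle.\<close>

lemma roots_attain:
  assumes a: "cmod a = 2 * real m" and b: "cmod b = 2 * real n" and \<kappa>: "\<kappa> = \<i>"
  shows "card R = n + 2 * m"
proof -
  have sin: "sin x = 1" if "cis x = \<kappa>" for x using that \<kappa> by (simp add: complex_eq_iff)
  have gap: "2 \<le> V 0 - U 0"
  proof -
    have "real m + 1 \<le> real n" using m_less by linarith
    then show ?thesis by (simp add: U_def V_def a b)
  qed
  have inner0: "real n * U 0 = real m * V 0" by (simp add: U_def V_def a b)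
  have sin_neq: "x \<noteq> real k * pi" "x \<noteq> - real k * pi" if "cis x = \<kappa>" for x k
    using sin[OF that] by auto
  have root: "\<exists>z\<in>R. T z = t \<and> sg z = \<epsilon>"
    if "triangle t" "\<epsilon> = 1 \<or> \<epsilon> = -1" "cis (\<epsilon> * D t) = \<kappa>" for t \<epsilon>
  proof (rule ex_root[OF that])
    have "sin (\<epsilon> * D t) \<noteq> 0" using sin[OF that(3)] by simp
    then have "sin (D t) \<noteq> 0" using that(2) by auto
    then show "sin (\<phi> t) \<noteq> 0" using sin_D_eq_0[OF that(1)] by blast
  qed

  let ?Bi = "{x. cis x = \<kappa> \<and> - real m * pi < x \<and> x \<le> - real m * pi + 2 * pi * real m}"
  have inner_sub: "?Bi \<subseteq> (\<lambda>z. sg z * D (T z)) ` {z \<in> R. inner (T z)}"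
  proof
    fix x assume x: "x \<in> ?Bi"
    define \<epsilon> where "\<epsilon> = sgn x"
    have "x \<noteq> 0" using x sin[of x] by auto
    then have \<epsilon>: "\<epsilon> = 1 \<or> \<epsilon> = -1" "x = \<epsilon> * \<bar>x\<bar>" by (auto simp: \<epsilon>_def sgn_if)
    obtain s where s: "s \<le> 0" "U s + V s \<le> 1" using ex_small[of 0] by blast
    have "V s - U s \<le> 1" using s(2) U_pos[of s] by linarith
    then have "\<exists>t. s \<le> t \<and> t \<le> 0 \<and> V t - U t = 1"
      using s gap by (intro IVT' continuous_intros continuous_U continuous_V) auto
    then obtain t2 where t2: "t2 \<le> 0" "V t2 = U t2 + 1" by force
    obtain t1 where t1: "t1 \<le> t2" "U t1 + V t1 = 1"
      using ex_U_plus_V_eq_1[of t2] t2(2) U_pos[of t2] by force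
    note d1 = degenerate(1)[OF t1(2)] and d2 = degenerate(2)[OF t2(2)]
    have in2: "inner t2" using inner_downward[OF _ t2(1)] inner0 by (simp add: inner_def)
    have tri: "triangle t" if "t1 \<le> t" "t \<le> t2" for t
      using triangle_between_inner[OF _ _ in2 that] d1 d2 by blast
    \<comment> \<open>\<open>D\<close> rises from \<open>0\<close> at \<open>t1\<close> to
      \<open>m * pi\<close> at \<open>t2\<close>; the sign of \<open>x\<close> becomes the
      orientation.\<close>
    have "\<exists>t. t1 \<le> t \<and> t \<le> t2 \<and> D t = \<bar>x\<bar>"
    proof (rule IVT')
      show "continuous_on {t1..t2} D" using tri by (intro continuous_D) simp
      show "\<bar>x\<bar> \<le> D t2" using x d2 by (auto simp: D_def mult.commute)
    qed (use t1 d1 in \<open>simp_all add: D_def\<close>)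
    then obtain t where t: "t1 \<le> t" "t \<le> t2" "D t = \<bar>x\<bar>" by blast
    have "cis (\<epsilon> * D t) = \<kappa>" using x \<epsilon>(2) t(3) by simp
    then obtain z where z: "z \<in> R" "T z = t" "sg z = \<epsilon>"
      using root[OF tri[OF t(1,2)] \<epsilon>(1)] by blast
    have "inner (T z)" using inner_downward[OF in2 t(2)] z(2) by simp
    moreover have "x = sg z * D (T z)" using z \<epsilon>(2) t(3) by simp
    ultimately show "x \<in> (\<lambda>z. sg z * D (T z)) ` {z \<in> R. inner (T z)}" using z(1) by blast
  qed

  let ?Bo = "{x. cis x = \<kappa> \<and> - real n * pi < x \<and> x \<le> - real n * pi + 2 * pi * real (n + m)}"
  have outer_sub: "?Bo \<subseteq> outer_code ` {z \<in> R. \<not> inner (T z)}"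
  proof
    fix x assume x: "x \<in> ?Bo"
    \<comment> \<open>Chosen so that \<open>exp s = n + 1\<close>; then
      \<open>q \<ge> n + 1\<close>, and \<open>U s - V s = exp (m * s) * (2 * q - 2 * n)\<close> is
      at least \<open>1\<close>.\<close>
    define s where "s = ln (real n + 1)"
    have s: "0 \<le> s" by (simp add: s_def)
    have "1 \<le> U s - V s"
    proof -
      define q where "q = real m * exp (real (n - m) * s)"
      have "real n * s = real m * s + real (n - m) * s"
        using m_less by (simp add: of_nat_diff algebra_simps)
      then have U: "U s = exp (real m * s) * (2 * q)"
        by (simp add: U_def a exp_add q_def)
      have "1 * s \<le> real (n - m) * s" using m_less s by (intro mult_right_mono) auto
      then have "exp s \<le> exp (real (n - m) * s)" by simp
      moreover have "exp s = real n + 1" by (simp add: s_def)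
      ultimately have "1 * (real n + 1) \<le> q"
        unfolding q_def using m_pos by (intro mult_mono) auto
      then have "1 \<le> 2 * q - 2 * real n" by simp
      then have "1 * 1 \<le> exp (real m * s) * (2 * q - 2 * real n)"
        using s by (intro mult_mono) auto
      then show ?thesis unfolding U V_def b by (simp add: algebra_simps)
    qed
    then have s1: "V s - U s \<le> -1" by simp
    have "\<exists>t. 0 \<le> t \<and> t \<le> s \<and> V t - U t = 1"
      using s s1 gap by (intro IVT2' continuous_intros continuous_U continuous_V) auto
    then obtain t3 where t3: "0 \<le> t3" "t3 \<le> s" "V t3 - U t3 = 1" by blast
    then have "t3 \<noteq> 0" using gap by auto
    with t3(1) have t3_pos: "0 < t3" by simp
    have "\<exists>t. t3 \<le> t \<and> t \<le> s \<and> V t - U t = -1"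
      using t3 s1 by (intro IVT2' continuous_intros continuous_U continuous_V) auto
    then obtain t4 where t4: "t3 \<le> t4" "V t4 - U t4 = -1" by blast
    have d3: "triangle t3 \<and> \<phi> t3 = pi \<and> \<psi> t3 = 0" using t3(3) by (intro degenerate) simp
    have d4: "triangle t4 \<and> \<phi> t4 = 0 \<and> \<psi> t4 = pi" using t4(2) by (intro degenerate) simp
    have out: "real m * V t < real n * U t" if "0 < t" for t
      using outer_after[OF _ that] inner0 by simp
    have tri: "triangle t" if "t3 \<le> t" "t \<le> t4" for t
      using triangle_between_outer[OF _ _ _ that] d3 d4 out[OF t3_pos] by force
    \<comment> \<open>Between \<open>t3\<close> and \<open>t4\<close> the function \<open>D\<close>
      falls from \<open>m * pi\<close> to \<open>- n * pi\<close>, and \<open>0 < t3\<close> keeps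
      the roots outside \<open>inner\<close>.\<close>
    have hit: "\<exists>z\<in>R. \<not> inner (T z) \<and> D (T z) = y \<and> sg z = \<epsilon>"
      if y: "- real n * pi \<le> y" "y \<le> real m * pi" and \<epsilon>: "\<epsilon> = 1 \<or> \<epsilon> = -1" and c: "cis (\<epsilon> * y) = \<kappa>" for y \<epsilon>
    proof -
      have "\<exists>t. t3 \<le> t \<and> t \<le> t4 \<and> D t = y"
      proof (rule IVT2')
        show "continuous_on {t3..t4} D" using tri by (intro continuous_D) simp
      qed (use y t4(1) d3 d4 in \<open>simp_all add: D_def\<close>)
      then obtain t where t: "t3 \<le> t" "t \<le> t4" "D t = y" by blast
      then obtain z where z: "z \<in> R" "T z = t" "sg z = \<epsilon>"
        using root[OF tri[OF t(1,2)] \<epsilon>] c by blast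
      have "\<not> inner (T z)" using t(1) out[of t] t3_pos z(2) by (simp add: inner_def)
      then show ?thesis using z t(3) by blast
    qed
    have cis: "cis x = \<kappa>" and bounds: "- (real n * pi) < x" "x \<le> real n * pi + 2 * (real m * pi)"
      using x by (simp_all add: algebra_simps)
    show "x \<in> outer_code ` {z \<in> R. \<not> inner (T z)}"
    proof (cases "x \<le> real m * pi")
      case True
      then obtain z where "z \<in> R" "\<not> inner (T z)" "D (T z) = x" "sg z = 1"
        using hit[of x 1] bounds cis by auto
      then show ?thesis by (intro image_eqI[of _ _ z]) (simp_all add: outer_code_def)
    next
      case False
      have "- real n * pi \<le> 2 * (real m * pi) - x" "2 * (real m * pi) - x \<le> real m * pi"
        using bounds False by linarith+
      moreover have "cis (-1 * (2 * (real m * pi) - x)) = \<kappa>"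
        using cis_2_mult_pi_minus[of m "x"] cis cis_cnj[of "2 * (real m * pi) - x"] cis_cnj[of "- x"] by simp
      ultimately obtain z where "z \<in> R" "\<not> inner (T z)" "D (T z) = 2 * (real m * pi) - x" "sg z = -1"
        using hit[of "2 * (real m * pi) - x" "-1"] by blast
      then show ?thesis by (intro image_eqI[of _ _ z]) (simp_all add: outer_code_def)
    qed
  qed

  have "m \<le> card {z \<in> R. inner (T z)}"
    using surj_card_le[OF card_inner_roots(1) inner_sub] unfolding card_cis_eq(2)[OF cmod_kappa] .
  moreover have "n + m \<le> card {z \<in> R. \<not> inner (T z)}"
    using surj_card_le[OF card_outer_roots(1) outer_sub] unfolding card_cis_eq(2)[OF cmod_kappa] .
  moreover have "card R = card {z \<in> R. inner (T z)} + card {z \<in> R. \<not> inner (T z)}"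
    by (subst (1) roots_split, rule card_Un_disjoint) (use card_inner_roots card_outer_roots in auto)
  ultimately show ?thesis using card_roots_le(2) by linarith
qed

end

section \<open>Reduction to coprime exponents\<close>

lemma card_power_preimage:
  fixes W :: "complex set"
  assumes "finite W" "0 \<notin> W" "0 < d"
  shows "finite {z. z ^ d \<in> W}" "card {z. z ^ d \<in> W} = d * card W"
proof -
  have *: "{z. z ^ d \<in> W} = (\<Union>w\<in>W. {z. z ^ d = w})" by auto
  have card: "card {z. z ^ d = w} = d" if "w \<in> W" for w
    using that assms by (intro card_nth_roots) auto
  then have fin: "finite {z. z ^ d = w}" if "w \<in> W" for w
    using that assms(3) by (metis card.infinite less_irrefl)
  show "finite {z. z ^ d \<in> W}" unfolding * using assms(1) fin by blast
  have "card {z. z ^ d \<in> W} = (\<Sum>w\<in>W. card {z. z ^ d = w})"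
    unfolding * using assms(1) fin by (intro card_UN_disjoint) auto
  then show "card {z. z ^ d \<in> W} = d * card W" by (simp add: card mult.commute)
qed

text \<open>Dividing by \<open>c\<close> normalises the equation, which then depends on
  \<open>z\<close> only through \<open>z ^ d\<close>. As \<open>0\<close> is not in
  \<open>R\<close>, each reduced root has exactly \<open>d\<close> preimages.\<close>

lemma roots_via_gcd:
  assumes "0 < m" "m < n" "a \<noteq> 0" "b \<noteq> 0" "c \<noteq> 0"
  defines "d \<equiv> gcd n m"
  shows "trinomial (n div d) (m div d) (- a / c) (- b / c)"
    and "finite (roots (\<lambda>z. a * z ^ n + b * cnj z ^ m + c))"
    and "card (roots (\<lambda>z. a * z ^ n + b * cnj z ^ m + c))
      = d * card (trinomial.R (n div d) (m div d) (- a / c) (- b / c))"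
proof -
  have d: "0 < d" "n = d * (n div d)" "m = d * (m div d)" using assms by (auto simp: d_def)
  have "n div d > m div d" using d(2,3) assms(2) d(1) by (metis nat_mult_less_cancel1)
  moreover have "0 < m div d" using d(3) assms(1) by (metis gr0I mult_0_right less_irrefl)
  moreover have "coprime (n div d) (m div d)" using assms unfolding d_def by (intro div_gcd_coprime) simp
  ultimately show loc: "trinomial (n div d) (m div d) (- a / c) (- b / c)"
    using assms by unfold_locales auto
  interpret trinomial "n div d" "m div d" "- a / c" "- b / c" by (fact loc)
  have "z \<in> roots (\<lambda>z. a * z ^ n + b * cnj z ^ m + c) \<longleftrightarrow> z ^ d \<in> R" for z
  proof -
    have *: "a * z ^ n + b * cnj z ^ m + c = c * (1 - (- a / c * z ^ n + - b / c * cnj z ^ m))"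
      using assms(5) by (simp add: field_simps)
    have "z \<in> roots (\<lambda>z. a * z ^ n + b * cnj z ^ m + c) \<longleftrightarrow> - a / c * z ^ n + - b / c * cnj z ^ m = 1"
      unfolding roots_def mem_Collect_eq * mult_eq_0_iff using assms(5) by (metis right_minus_eq)
    also have "\<dots> \<longleftrightarrow> z ^ d \<in> R" unfolding R_def using d(2,3) by (simp flip: power_mult)
    finally show ?thesis .
  qed
  then have *: "roots (\<lambda>z. a * z ^ n + b * cnj z ^ m + c) = {z. z ^ d \<in> R}" by blast
  have "0 \<notin> R" using root_norm(1) by blast
  then show "finite (roots (\<lambda>z. a * z ^ n + b * cnj z ^ m + c))"
    and "card (roots (\<lambda>z. a * z ^ n + b * cnj z ^ m + c)) = d * card R"
    unfolding * using card_power_preimage card_roots_le(1) d(1) by blast+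
qed

theorem corollary1p4:
  fixes n m :: nat
  assumes "0 < m" and "m < n"
  shows "(\<forall>f. harmonic_trinomial n m f \<longrightarrow> finite (roots f) \<and> card (roots f) \<le> n + 2 * m) \<and>
         (\<exists>g :: real \<Rightarrow> complex \<Rightarrow> complex. \<forall>r>0. harmonic_trinomial n m (g r) \<and>
            finite (roots (g r)) \<and> card (roots (g r)) = n + 2 * m)"
proof (intro conjI allI impI)
  define d where "d = gcd n m"
  define n' where "n' = n div d"
  define m' where "m' = m div d"
  have d: "n = d * n'" "m = d * m'" by (simp_all add: d_def n'_def m'_def)
  have total: "n + 2 * m = d * (n' + 2 * m')" using d by (simp add: algebra_simps)
  fix f assume "harmonic_trinomial n m f"
  then obtain a b c where nz: "a \<noteq> 0" "b \<noteq> 0" "c \<noteq> 0" and f: "f = (\<lambda>z. a * z ^ n + b * cnj z ^ m + c)"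
    by (auto simp: harmonic_trinomial_def)
  note via = roots_via_gcd[OF assms nz, folded d_def, folded n'_def m'_def f]
  show "finite (roots f)" by (fact via(2))
  show "card (roots f) \<le> n + 2 * m"
    using trinomial.card_roots_le(2)[OF via(1)] unfolding via(3) total by simp
next
  define d where "d = gcd n m"
  define n' where "n' = n div d"
  define m' where "m' = m div d"
  have d: "n = d * n'" "m = d * m'" by (simp_all add: d_def n'_def m'_def)
  have pos: "0 < m'" "0 < n'" using d assms by (auto intro: gr0I)
  have total: "n + 2 * m = d * (n' + 2 * m')" using d by (simp add: algebra_simps)
  \<comment> \<open>Chosen so that \<open>u ^ m' = \<i>\<close>; with \<open>b\<close> positive and
    constant term \<open>-1\<close> this makes \<open>\<kappa> = \<i>\<close>.\<close>
  define u where "u = cis (pi / (2 * real m'))"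
  define a where "a = 2 * of_nat m' * u"
  define b :: complex where "b = 2 * of_nat n'"
  define f where "f = (\<lambda>z. a * z ^ n + b * cnj z ^ m + (-1))"
  have nz: "a \<noteq> 0" "b \<noteq> 0" "(-1::complex) \<noteq> 0" using pos by (simp_all add: a_def b_def u_def)
  note via = roots_via_gcd[OF assms nz, folded d_def, folded n'_def m'_def f_def, simplified]
  have "trinomial.\<kappa> n' m' a b = \<i>"
  proof -
    have "sgn a = u" "sgn b = 1"
      using pos by (simp_all add: a_def b_def u_def sgn_eq norm_mult)
    moreover have "u ^ m' = \<i>" using pos by (simp add: u_def DeMoivre)
    ultimately show ?thesis by (simp add: trinomial.\<kappa>_def[OF via(1)])
  qed
  moreover have "cmod a = 2 * real m'" "cmod b = 2 * real n'"
    by (simp_all add: a_def b_def u_def norm_mult)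
  ultimately have "card (roots f) = n + 2 * m"
    using trinomial.roots_attain[OF via(1)] via(3) total by simp
  moreover have "harmonic_trinomial n m f"
    unfolding harmonic_trinomial_def f_def using nz by blast
  ultimately show "\<exists>g :: real \<Rightarrow> complex \<Rightarrow> complex. \<forall>r>0. harmonic_trinomial n m (g r) \<and>
            finite (roots (g r)) \<and> card (roots (g r)) = n + 2 * m"
    \<comment> \<open>One trinomial serves for all \<open>r\<close>: the family is constant.\<close>
    using via(2) by (intro exI[of _ "\<lambda>_. f"]) simp
qed

end
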